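(* Let $a,b\ge1$ be integers. The cube coefficients $c_k(\Pi^{a,b}_n)$ of the Horadam cubes satisfy, for all $n\ge2$ and $k\ge0$, $$c_k(\Pi^{a,b}_n)=a\,c_k(\Pi^{a,b}_{n-1})+b\,c_k(\Pi^{a,b}_{n-2})+(a-1)\,c_{k-1}(\Pi^{a,b}_{n-1})+b\,c_{k-1}(\Pi^{a,b}_{n-2}),$$ where $c_{-1}:=0$, with initial values $c_0(\Pi^{a,b}_n)=s^{a,b}_n$ for $n\ge 0$ and $c_1(\Pi^{a,b}_1)=a-1$. Furthermore, their generating function $A(x,y)=\sum_{n\ge0,\,k\ge0}c_k(\Pi^{a,b}_n)x^ny^k$ is $$A(x,y)=\frac{1}{1-ax-bx^2-(a-1)xy-bx^2y}.$$
   Context: For integers $a,b\ge1$ and $n\ge 0$, $\mathcal S^{a,b}_n$ is the set of all strings of length $n$ over the alphabet $\{0,1,\dots,a+b-1\}$ in which every letter from $\{a,\dots,a+b-1\}$ appears only immediately after a letter $0$; $\mathcal S^{a,b}_0$ contains only the empty string. The Horadam cube $\Pi^{a,b}_n$ is the simple graph with vertex set $\mathcal S^{a,b}_n$ in which $x_1\cdots x_n$ and $y_1\cdots y_n$ are adjacent if and only if $\sum_{i=1}^n|x_i-y_i|=1$. $s^{a,b}_n=|\mathcal S^{a,b}_n|$, so $s^{a,b}_0=1$, $s^{a,b}_1=a$, $s^{a,b}_n=as^{a,b}_{n-1}+bs^{a,b}_{n-2}$ for $n\ge2$. For a graph $G$ and $k\ge0$, the cube coefficient $c_k(G)$ is the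 number of induced subgraphs of $G$ isomorphic to the $k$-dimensional hypercube $Q_k$ (so $c_0(G)=|V(G)|$, $c_1(G)=|E(G)|$). The generating function is a formal power series. *)

theory Defs
  imports
    "Graph_Theory.Graph_Theory"
    "HOL-Computational_Algebra.Formal_Power_Series"
begin

text \<open>
  A simple graph is represented as a \<open>pair_graph\<close>, i.e. as a finite loopless digraph whose arc
  relation is symmetric: every undirected edge is given by its two opposite arcs. Induced
  subgraphs and isomorphisms of such digraphs are those of the underlying undirected graphs.
\<close>

definition horadam_strings :: "nat \<Rightarrow> nat \<Rightarrow> nat \<Rightarrow> nat list set" where
  "horadam_strings a b n =
     {xs. length xs = n \<and> set xs \<subseteq> {0..<a + b} \<and>
          (\<forall>i<n. a \<le> xs ! i \<longrightarrow> 0 < i \<and> xs ! (i - 1) = 0)}"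

definition horadam_number :: "nat \<Rightarrow> nat \<Rightarrow> nat \<Rightarrow> nat" where
  "horadam_number a b n = card (horadam_strings a b n)"

definition horadam_cube :: "nat \<Rightarrow> nat \<Rightarrow> nat \<Rightarrow> nat list pair_pre_digraph" where
  "horadam_cube a b n =
     \<lparr>pverts = horadam_strings a b n,
      parcs = {(xs, ys). xs \<in> horadam_strings a b n \<and> ys \<in> horadam_strings a b n \<and>
                         (\<Sum>i<n. \<bar>int (xs ! i) - int (ys ! i)\<bar>) = 1}\<rparr>"

definition hypercube :: "nat \<Rightarrow> bool list pair_pre_digraph" where
  "hypercube k =
     \<lparr>pverts = {xs. length xs = k},
      parcs = {(xs, ys). length xs = k \<and> length ys = k \<and> card {i. i < k \<and> xs ! i \<noteq> ys ! i} = 1}\<rparr>"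

lemma finite_horadam_strings: "finite (horadam_strings a b n)"
  by (rule finite_subset[OF _ finite_lists_length_eq[of "{0..<a + b}" n]])
     (auto simp: horadam_strings_def)

lemma pair_graph_horadam_cube: "pair_graph (horadam_cube a b n)"
proof
  show "finite (parcs (horadam_cube a b n))"
    by (rule finite_subset[of _ "horadam_strings a b n \<times> horadam_strings a b n"])
       (auto simp: horadam_cube_def finite_horadam_strings)
qed (auto simp: horadam_cube_def finite_horadam_strings symmetric_def sym_def abs_minus_commute)

lemma pair_graph_hypercube: "pair_graph (hypercube k)"
proof -
  have fin: "finite {xs :: bool list. length xs = k}"
    using finite_lists_length_eq[of "UNIV :: bool set" k] by simp
  show ?thesis
  proof
    show "symmetric (with_proj (hypercube k))"
      unfolding symmetric_def
    proof (rule symI)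
      fix xs ys :: "bool list"
      assume "(xs, ys) \<in> arcs_ends (with_proj (hypercube k))"
      then have len: "length xs = k" "length ys = k"
        and diff: "card {i. i < k \<and> xs ! i \<noteq> ys ! i} = 1"
        by (simp_all add: hypercube_def)
      have eq: "{i. i < k \<and> xs ! i \<noteq> ys ! i} = {i. i < k \<and> ys ! i \<noteq> xs ! i}"
        by metis
      have "card {i. i < k \<and> ys ! i \<noteq> xs ! i} = 1"
        by (rule subst[where P = "\<lambda>A. card A = 1", OF eq diff])
      with len show "(ys, xs) \<in> arcs_ends (with_proj (hypercube k))"
        by (simp add: hypercube_def)
    qed
    show "finite (parcs (hypercube k))"
      by (rule finite_subset[of _ "{xs. length xs = k} \<times> {xs. length xs = k}"])
         (auto simp: hypercube_def fin)
    show "fst e \<noteq> snd e" if "e \<in> parcs (hypercube k)" for e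
    proof
      assume "fst e = snd e"
      with that show False
        by (simp add: hypercube_def split_beta)
    qed
  qed (simp_all add: hypercube_def fin split_beta)
qed

text \<open>
  Induced subgraphs are counted as subgraphs, not up to isomorphism.
\<close>

definition cube_coeff :: "nat \<Rightarrow> 'a pair_pre_digraph \<Rightarrow> nat" where
  "cube_coeff k G =
     card {H :: 'a pair_pre_digraph.
             induced_subgraph (with_proj H) (with_proj G) \<and>
             digraph_iso (with_proj H) (with_proj (hypercube k))}"

text \<open>
  Bivariate formal power series are series in \<open>x\<close> (outer variable) whose coefficients are series
  in \<open>y\<close> (inner variable): \<open>x\<close> is \<open>fps_X\<close> and \<open>y\<close> is \<open>fps_const fps_X\<close>.
\<close>

definition horadam_gf :: "nat \<Rightarrow> nat \<Rightarrow> rat fps fps" where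
  "horadam_gf a b =
     Abs_fps (\<lambda>n. Abs_fps (\<lambda>k. of_nat (cube_coeff k (horadam_cube a b n))))"

end

theory Submission
  imports Defs
begin

text \<open>
  The Horadam cube is an induced subgraph of the grid. Opposite sides of a 4-cycle in the grid are
  parallel, so by induction on \<open>k\<close> every copy of \<open>Q_k\<close> in the grid is a box, i.e. a product of \<open>k\<close>
  edges and single vertices. A box consists of Horadam strings iff this can be checked letter by
  letter while remembering only whether the previous coordinate is constantly \<open>0\<close>. Let \<open>F n k\<close>
  and \<open>T n k\<close> count the admissible \<open>k\<close>-dimensional boxes of length \<open>n\<close> at the start of a string
  and after a letter \<open>0\<close>, respectively. Splitting off the first coordinate gives
  \<open>F (n+1) k = T n k + (a-1) F n k + (a-1) F n (k-1)\<close> and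
  \<open>T (n+1) k = F (n+1) k + b F n k + b F n (k-1)\<close>; eliminating \<open>T\<close> gives the recurrence.
\<close>

section \<open>Induced hypercubes as vertex sets\<close>

text \<open>The library's isomorphisms carry separate maps for vertices and arcs. Here tail and head
  are \<open>fst\<close> and \<open>snd\<close> on both sides, which forces the arc map to be
  \<open>map_prod f f\<close> on the arcs, so a vertex map alone suffices.\<close>

lemma pair_digraph_iso_iff:
  assumes "pair_wf_digraph G"
  shows "digraph_iso (with_proj G) (with_proj H) \<longleftrightarrow>
    (\<exists>f. inj_on f (pverts G) \<and> f ` pverts G = pverts H \<and> map_prod f f ` parcs G = parcs H)"
proof
  assume "digraph_iso (with_proj G) (with_proj H)"
  then obtain h where h: "pre_digraph.digraph_isomorphism (with_proj G) h"
    "with_proj H = app_iso h (with_proj G)"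
    unfolding digraph_iso_def by blast
  have vs: "pverts H = iso_verts h ` pverts G" and as: "parcs H = iso_arcs h ` parcs G"
    and ht: "iso_tail h = fst" "iso_head h = snd"
    using arg_cong[OF h(2), of verts] arg_cong[OF h(2), of arcs]
      arg_cong[OF h(2), of tail] arg_cong[OF h(2), of head] by simp_all
  have "iso_arcs h e = map_prod (iso_verts h) (iso_verts h) e" if "e \<in> parcs G" for e
    using h(1) that ht by (auto simp: pre_digraph.digraph_isomorphism_def prod_eq_iff)
  then have "parcs H = map_prod (iso_verts h) (iso_verts h) ` parcs G"
    unfolding as by (rule image_cong[OF refl])
  with vs h(1) show "\<exists>f. inj_on f (pverts G) \<and> f ` pverts G = pverts H \<and>
      map_prod f f ` parcs G = parcs H"
    by (auto simp: pre_digraph.digraph_isomorphism_def)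
next
  assume "\<exists>f. inj_on f (pverts G) \<and> f ` pverts G = pverts H \<and> map_prod f f ` parcs G = parcs H"
  then obtain f where f: "inj_on f (pverts G)" "f ` pverts G = pverts H"
    "map_prod f f ` parcs G = parcs H" by blast
  interpret pair_wf_digraph G by fact
  define h where "h = \<lparr>iso_verts = f, iso_arcs = map_prod f f, iso_head = snd, iso_tail = fst\<rparr>"
  have "parcs G \<subseteq> pverts G \<times> pverts G"
    using wellformed' by auto
  then have "inj_on (map_prod f f) (parcs G)"
    using map_prod_inj_on[OF f(1) f(1)] by (rule inj_on_subset[rotated])
  then have "pre_digraph.digraph_isomorphism (with_proj G) h"
    using f(1) wf_digraph_axioms by (simp add: pre_digraph.digraph_isomorphism_def h_def)
  moreover have "with_proj H = app_iso h (with_proj G)"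
    using f by (simp add: h_def app_iso_def with_proj_def)
  ultimately show "digraph_iso (with_proj G) (with_proj H)"
    unfolding digraph_iso_def by blast
qed

definition induced_pair :: "'a pair_pre_digraph \<Rightarrow> 'a set \<Rightarrow> 'a pair_pre_digraph" where
  "induced_pair G V = \<lparr>pverts = V, parcs = parcs G \<inter> V \<times> V\<rparr>"

lemma induced_subgraph_pair_iff:
  assumes "pair_wf_digraph G"
  shows "induced_subgraph (with_proj H) (with_proj G) \<longleftrightarrow>
    (\<exists>V\<subseteq>pverts G. H = induced_pair G V)"
proof
  assume "induced_subgraph (with_proj H) (with_proj G)"
  then have "pverts H \<subseteq> pverts G" "parcs H = parcs G \<inter> pverts H \<times> pverts H"
    by (auto simp: induced_subgraph_def subgraph_def)
  then show "\<exists>V\<subseteq>pverts G. H = induced_pair G V"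
    by (intro exI[of _ "pverts H"]) (simp add: induced_pair_def)
next
  assume "\<exists>V\<subseteq>pverts G. H = induced_pair G V"
  then obtain V where V: "V \<subseteq> pverts G" "H = induced_pair G V" by blast
  have "pair_wf_digraph H"
    by unfold_locales (auto simp: V(2) induced_pair_def)
  then show "induced_subgraph (with_proj H) (with_proj G)"
    using assms V by (auto simp: induced_subgraph_def subgraph_def wf_digraph_wp_iff induced_pair_def)
qed

text \<open>An induced subgraph is determined by its vertex set, so \<open>induced_pair G\<close> is
  injective and sets can be counted instead of graphs. The isomorphism is reversed so that
  \<open>f\<close> parametrizes the set by bit strings.\<close>

lemma cube_coeff_eq_card_vertex_sets:
  assumes "pair_wf_digraph G"
  shows "cube_coeff k G = card {V. V \<subseteq> pverts G \<and>
    (\<exists>f. inj_on f (pverts (hypercube k)) \<and> f ` pverts (hypercube k) = V \<and>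
         map_prod f f ` parcs (hypercube k) = parcs G \<inter> V \<times> V)}" (is "_ = card ?W")
proof -
  have wfQ: "pair_wf_digraph (hypercube k)"
    using pair_graph_hypercube[of k]
    by (simp add: pair_graph_def pair_digraph_def pair_fin_digraph_def)
  have wfi: "pair_wf_digraph (induced_pair G V)" for V
    by unfold_locales (auto simp: induced_pair_def)
  have iso: "digraph_iso (with_proj (induced_pair G V)) (with_proj (hypercube k)) \<longleftrightarrow>
      (\<exists>f. inj_on f (pverts (hypercube k)) \<and> f ` pverts (hypercube k) = V \<and>
           map_prod f f ` parcs (hypercube k) = parcs G \<inter> V \<times> V)" for V
  proof -
    have "digraph_iso (with_proj (induced_pair G V)) (with_proj (hypercube k)) \<longleftrightarrow>
        digraph_iso (with_proj (hypercube k)) (with_proj (induced_pair G V))"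
      using digraph_iso_swap wfQ wfi by (metis wf_digraph_wp_iff)
    then show ?thesis
      by (simp add: pair_digraph_iso_iff[OF wfQ] induced_pair_def)
  qed
  have "{H. induced_subgraph (with_proj H) (with_proj G) \<and>
      digraph_iso (with_proj H) (with_proj (hypercube k))} = induced_pair G ` ?W"
    unfolding induced_subgraph_pair_iff[OF assms] iso[symmetric] by blast
  moreover have "inj_on (induced_pair G) ?W"
    by (rule inj_onI) (simp add: induced_pair_def)
  ultimately show ?thesis
    by (simp add: cube_coeff_def card_image)
qed

section \<open>Adjacency in the hypercube and in the grid, by recursion on the first
  coordinate\<close>

fun flip_adj :: "bool list \<Rightarrow> bool list \<Rightarrow> bool" where
  "flip_adj (x # xs) (y # ys) = (x = y \<and> flip_adj xs ys \<or> x \<noteq> y \<and> xs = ys)"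
| "flip_adj _ _ = False"

fun grid_adj :: "nat list \<Rightarrow> nat list \<Rightarrow> bool" where
  "grid_adj (x # xs) (y # ys) =
    (x = y \<and> grid_adj xs ys \<or> (y = Suc x \<or> x = Suc y) \<and> xs = ys)"
| "grid_adj _ _ = False"

lemma flip_adj_length: "flip_adj xs ys \<Longrightarrow> length xs = length ys"
  by (induction xs ys rule: flip_adj.induct) auto

lemma grid_adj_length: "grid_adj xs ys \<Longrightarrow> length xs = length ys"
  by (induction xs ys rule: grid_adj.induct) auto

lemma card_diff_eq_1_iff_flip_adj:
  assumes "length xs = length ys"
  shows "card {i. i < length xs \<and> xs ! i \<noteq> ys ! i} = 1 \<longleftrightarrow> flip_adj xs ys"
  using assms
proof (induction xs ys rule: list_induct2)
  case (Cons x xs y ys)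
  have eq: "{i. i < length (x # xs) \<and> (x # xs) ! i \<noteq> (y # ys) ! i} =
      (if x = y then {} else {0}) \<union> Suc ` {i. i < length xs \<and> xs ! i \<noteq> ys ! i}"
    (is "?L = ?R")
  proof (rule set_eqI)
    show "i \<in> ?L \<longleftrightarrow> i \<in> ?R" for i
      by (cases i) auto
  qed
  have "card {i. i < length xs \<and> xs ! i \<noteq> ys ! i} = 0 \<longleftrightarrow> xs = ys"
    using Cons.hyps by (auto simp: list_eq_iff_nth_eq)
  then show ?case
    unfolding eq using Cons.IH by (auto simp: card_image)
qed simp

text \<open>A sum of nonnegative integers is 1 iff one of two cases holds: the first term is 0 and
  the rest is 1, or the first term is 1 and the rest vanishes. These are the two cases of
  \<open>grid_adj\<close>.\<close>

lemma l1_dist_eq_1_iff_grid_adj: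
  assumes "length xs = length ys"
  shows "(\<Sum>i<length xs. \<bar>int (xs ! i) - int (ys ! i)\<bar>) = 1 \<longleftrightarrow> grid_adj xs ys"
  using assms
proof (induction xs ys rule: list_induct2)
  case (Cons x xs y ys)
  define s where "s = (\<Sum>i<length xs. \<bar>int (xs ! i) - int (ys ! i)\<bar>)"
  have "s \<ge> 0" by (simp add: s_def sum_nonneg)
  then have "\<bar>int x - int y\<bar> + s = 1 \<longleftrightarrow>
      x = y \<and> s = 1 \<or> (y = Suc x \<or> x = Suc y) \<and> s = 0"
    by presburger
  moreover have "s = 0 \<longleftrightarrow> xs = ys"
    using Cons.hyps by (auto simp: s_def sum_nonneg_eq_0_iff list_eq_iff_nth_eq)
  moreover have "(\<Sum>i<length (x # xs). \<bar>int ((x # xs) ! i) - int ((y # ys) ! i)\<bar>) =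
      \<bar>int x - int y\<bar> + s"
    by (simp add: s_def sum.lessThan_Suc_shift del: sum.lessThan_Suc)
  moreover have "s = 1 \<longleftrightarrow> grid_adj xs ys"
    using Cons.IH by (simp add: s_def)
  ultimately show ?case
    by (simp only: grid_adj.simps)
qed simp

lemma hypercube_simps:
  "pverts (hypercube k) = {xs. length xs = k}"
  "parcs (hypercube k) = {(xs, ys). length xs = k \<and> length ys = k \<and> flip_adj xs ys}"
  by (auto simp: hypercube_def card_diff_eq_1_iff_flip_adj[symmetric])

lemma length_horadam_strings: "xs \<in> horadam_strings a b n \<Longrightarrow> length xs = n"
  by (simp add: horadam_strings_def)

lemma horadam_cube_simps:
  "pverts (horadam_cube a b n) = horadam_strings a b n"
  "parcs (horadam_cube a b n) =
    {(xs, ys). xs \<in> horadam_strings a b n \<and> ys \<in> horadam_strings a b n \<and> grid_adj xs ys}"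
  by (auto simp: horadam_cube_def l1_dist_eq_1_iff_grid_adj[symmetric] length_horadam_strings)

section \<open>Hypercubes in the grid are boxes\<close>

text \<open>Connectedness of the hypercube as an induction principle: first the tail is changed with
  the leading bit fixed, then the leading bit is flipped.\<close>

lemma flip_adj_connected:
  assumes "length xs = length ys"
    and "\<And>zs ws. flip_adj zs ws \<Longrightarrow> length zs = length xs \<Longrightarrow> P zs \<Longrightarrow> P ws" and "P xs"
  shows "P ys"
  using assms
proof (induction xs ys arbitrary: P rule: list_induct2)
  case (Cons x xs y ys)
  have "P (x # ys)"
  proof (rule Cons.IH[where P = "\<lambda>zs. P (x # zs)"])
    show "P (x # ws)" if "flip_adj zs ws" "length zs = length xs" "P (x # zs)" for zs ws
      using Cons.prems(1)[of "x # zs" "x # ws"] that by simp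
  qed (rule Cons.prems(2))
  then show ?case
    using Cons.prems(1)[of "x # ys" "y # ys"] Cons.hyps by (cases "x = y") auto
qed simp

section \<open>Grid edges with a direction \<open>j\<close> and an orientation\<close>

definition raised :: "nat \<Rightarrow> nat list \<Rightarrow> nat list \<Rightarrow> bool" where
  "raised j xs ys \<longleftrightarrow> j < length xs \<and> ys = xs[j := Suc (xs ! j)]"

lemma raised_Cons_0: "raised 0 (x # xs) ys \<longleftrightarrow> ys = Suc x # xs"
  by (auto simp: raised_def)

lemma raised_Cons_Suc: "raised (Suc j) (x # xs) (y # ys) \<longleftrightarrow> x = y \<and> raised j xs ys"
  by (auto simp: raised_def)

lemma raised_iff:
  "raised j xs ys \<longleftrightarrow> length ys = length xs \<and> j < length xs \<and> ys ! j = Suc (xs ! j) \<and>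
    (\<forall>i<length xs. i \<noteq> j \<longrightarrow> ys ! i = xs ! i)"
  by (auto simp: raised_def list_eq_iff_nth_eq nth_list_update)

lemma raised_nth: "raised j xs ys \<Longrightarrow> ys ! j = Suc (xs ! j)"
  by (simp add: raised_iff)

lemma raised_unique: "raised j xs ys \<Longrightarrow> raised j xs zs \<Longrightarrow> ys = zs"
  by (simp add: raised_def)

lemma raised_inj: "raised j xs zs \<Longrightarrow> raised j ys zs \<Longrightarrow> xs = ys"
  unfolding raised_iff by (rule nth_equalityI) (simp, metis Suc_inject)

lemma grid_adj_iff_raised: "grid_adj xs ys \<longleftrightarrow> (\<exists>j. raised j xs ys \<or> raised j ys xs)"
proof (induction xs ys rule: grid_adj.induct)
  case (1 x xs y ys)
  have "(\<exists>j. P j) \<longleftrightarrow> P 0 \<or> (\<exists>j. P (Suc j))" for P :: "nat \<Rightarrow> bool"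
    by (metis not0_implies_Suc)
  from this[of "\<lambda>j. raised j (x # xs) (y # ys) \<or> raised j (y # ys) (x # xs)"] show ?case
    by (auto simp: raised_Cons_0 raised_Cons_Suc 1)
qed (auto simp: raised_iff)

lemma grid_adj_differ_nth:
  assumes "grid_adj xs ys" "j < length xs" "xs ! j \<noteq> ys ! j"
  shows "raised j xs ys \<or> raised j ys xs"
  using assms unfolding grid_adj_iff_raised by (metis raised_iff)

text \<open>Going from \<open>p\<close> to \<open>q\<close> cannot raise coordinate
  \<open>j\<close>, else \<open>q = s\<close>; going from \<open>r\<close> to \<open>s\<close>
  cannot either, else \<open>r = p\<close>. So \<open>q ! j \<le> p ! j < s ! j \<le> r ! j\<close>,
  and the edge between \<open>q\<close> and \<open>r\<close> must raise \<open>j\<close>.\<close>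

lemma grid_square_parallel:
  assumes ps: "raised j p s" and pq: "grid_adj p q" and qr: "grid_adj q r" and rs: "grid_adj r s"
    and ne: "p \<noteq> r" "q \<noteq> s"
  shows "raised j q r"
proof -
  have len: "j < length p" "length q = length p" "length r = length p" "length s = length p"
    using ps grid_adj_length[OF pq] grid_adj_length[OF qr] by (auto simp: raised_iff)
  have sj: "s ! j = Suc (p ! j)" using ps by (simp add: raised_iff)
  have pq': "p ! j = q ! j \<or> raised j p q \<or> raised j q p"
    using grid_adj_differ_nth[OF pq] len by auto
  have qr': "q ! j = r ! j \<or> raised j q r \<or> raised j r q"
    using grid_adj_differ_nth[OF qr] len by auto
  have rs': "r ! j = s ! j \<or> raised j r s \<or> raised j s r"
    using grid_adj_differ_nth[OF rs] len by auto
  have "\<not> raised j r s" using ps ne raised_inj by blast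
  then have rj: "r ! j = s ! j \<or> r ! j = Suc (s ! j)" using rs' raised_nth by blast
  have "\<not> raised j p q" using ps ne raised_unique by blast
  then have qj: "p ! j = q ! j \<or> p ! j = Suc (q ! j)" using pq' raised_nth by blast
  have "q ! j < r ! j" using sj rj qj by linarith
  moreover have "q ! j = Suc (r ! j)" if "raised j r q" using that by (rule raised_nth)
  ultimately show ?thesis
    using qr' by (metis Suc_lessD less_irrefl)
qed

text \<open>
  A descriptor \<open>(c, e)\<close> stands for the vertex \<open>c\<close> or, if \<open>e\<close> holds, for the edge from \<open>c\<close> to \<open>c + 1\<close>.
\<close>

fun cell :: "nat \<times> bool \<Rightarrow> nat set" where
  "cell (c, e) = (if e then {c, Suc c} else {c})"

definition box :: "(nat \<times> bool) list \<Rightarrow> nat list set" where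
  "box ds = {xs. list_all2 (\<lambda>x d. x \<in> cell d) xs ds}"

abbreviation dims :: "(nat \<times> bool) list \<Rightarrow> nat" where
  "dims ds \<equiv> length (filter snd ds)"

lemma box_Nil [simp]: "box [] = {[]}"
  by (simp add: box_def)

lemma Cons_in_box_Cons [simp]: "x # xs \<in> box (d # ds) \<longleftrightarrow> x \<in> cell d \<and> xs \<in> box ds"
  by (simp add: box_def)

lemma box_Cons: "box (d # ds) = (\<lambda>(x, xs). x # xs) ` (cell d \<times> box ds)"
  by (auto simp: box_def list_all2_Cons2)

lemma in_box_iff_nth:
  "xs \<in> box ds \<longleftrightarrow> length xs = length ds \<and> (\<forall>i<length ds. xs ! i \<in> cell (ds ! i))"
  by (auto simp: box_def list_all2_conv_all_nth)

lemma fst_in_cell: "fst d \<in> cell d"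
  by (cases d) auto

lemma corner_in_box: "map fst ds \<in> box ds"
  by (simp add: in_box_iff_nth fst_in_cell)

lemma cell_inject: "cell d = cell e \<Longrightarrow> d = e"
  by (cases d; cases e) (auto simp: doubleton_eq_iff split: if_splits)

text \<open>Nonempty products determine their factors. Hence counting boxes amounts to counting
  descriptor lists.\<close>

lemma box_inject: "box ds = box es \<Longrightarrow> ds = es"
proof (induction ds arbitrary: es)
  case Nil
  from corner_in_box[of es] have "map fst es = []" unfolding Nil[symmetric] by simp
  then show ?case by simp
next
  case (Cons d ds)
  have "length (d # ds) = length es"
    using corner_in_box[of "d # ds"] Cons.prems by (simp only: in_box_iff_nth length_map)
  then obtain e es' where es: "es = e # es'" by (cases es) auto
  have "x \<in> cell d \<and> xs \<in> box ds \<longleftrightarrow> x \<in> cell e \<and> xs \<in> box es'" for x xs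
    using Cons.prems unfolding es by (metis Cons_in_box_Cons)
  then have "cell d \<times> box ds = cell e \<times> box es'" by auto
  then have "cell d = cell e" "box ds = box es'"
    using corner_in_box[of ds] fst_in_cell[of d] unfolding times_eq_iff by blast+
  with Cons.IH cell_inject es show ?case by blast
qed

lemma box_singleton: "box (map (\<lambda>c. (c, False)) xs) = {xs}"
  by (auto simp: in_box_iff_nth list_eq_iff_nth_eq)

text \<open>Joining a box to its disjoint translate by one step in direction \<open>j\<close> widens
  the \<open>j\<close>-th cell from a vertex to an edge.\<close>

lemma union_raised_box:
  assumes box: "g ` X = box ds" and raise: "\<And>x. x \<in> X \<Longrightarrow> raised j (g x) (h x)"
    and disj: "g ` X \<inter> h ` X = {}"
  shows "\<exists>es. g ` X \<union> h ` X = box es"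
proof -
  have hX: "h ` X = {q. \<exists>p\<in>box ds. raised j p q}"
  proof (rule set_eqI)
    fix q
    have "q = h x \<longleftrightarrow> raised j (g x) q" if "x \<in> X" for x
      using raise[OF that] raised_unique by metis
    then show "q \<in> h ` X \<longleftrightarrow> q \<in> {q. \<exists>p\<in>box ds. raised j p q}"
      unfolding box[symmetric] by auto
  qed
  obtain x where x: "x \<in> X" "g x = map fst ds"
    using corner_in_box[of ds] unfolding box[symmetric] by auto
  have j: "j < length ds" "h x = (map fst ds)[j := Suc (fst (ds ! j))]"
    using raise[OF x(1)] x(2) by (auto simp: raised_def)
  define c where "c = fst (ds ! j)"
  \<comment> \<open>If the \<open>j\<close>-th cell were already an edge, raising the lowest corner
    at \<open>j\<close> would stay inside the box, against \<open>disj\<close>.\<close>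
  have not_ext: "\<not> snd (ds ! j)"
  proof
    assume "snd (ds ! j)"
    then have "ds ! j = (c, True)" by (simp add: c_def prod_eq_iff)
    then have "h x \<in> box ds"
      using j by (auto simp: in_box_iff_nth nth_list_update fst_in_cell)
    with x disj box show False by blast
  qed
  then have dj: "ds ! j = (c, False)" by (simp add: c_def prod_eq_iff)
  have "y \<in> g ` X \<union> h ` X \<longleftrightarrow> y \<in> box (ds[j := (c, True)])" for y
  proof
    assume "y \<in> g ` X \<union> h ` X"
    then show "y \<in> box (ds[j := (c, True)])"
    proof
      assume "y \<in> g ` X"
      with dj j(1) show ?thesis unfolding box by (auto simp: in_box_iff_nth nth_list_update)
    next
      assume "y \<in> h ` X"
      then obtain p where "p \<in> box ds" "raised j p y" unfolding hX by blast
      with dj j(1) show ?thesis by (auto simp: in_box_iff_nth nth_list_update raised_def)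
    qed
  next
    assume y: "y \<in> box (ds[j := (c, True)])"
    then have len: "length y = length ds" and yj: "y ! j = c \<or> y ! j = Suc c"
      and yi: "\<And>i. i < length ds \<Longrightarrow> i \<noteq> j \<Longrightarrow> y ! i \<in> cell (ds ! i)"
      using j(1) by (auto simp: in_box_iff_nth nth_list_update split: if_splits)
    from yj show "y \<in> g ` X \<union> h ` X"
    proof
      assume "y ! j = c"
      then have "y \<in> box ds"
        using len yi dj unfolding in_box_iff_nth by (metis cell.simps insertI1)
      then show ?thesis using box by blast
    next
      assume "y ! j = Suc c"
      \<comment> \<open>Lowering coordinate \<open>j\<close> back to \<open>c\<close> gives the
        point of the original box below \<open>y\<close>.\<close>
      then have "raised j (y[j := c]) y"
        using len j(1) by (simp add: raised_iff)
      moreover have "y[j := c] \<in> box ds"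
        using len yi dj j(1) by (auto simp: in_box_iff_nth nth_list_update)
      ultimately show ?thesis unfolding hX by blast
    qed
  qed
  then show ?thesis by blast
qed

text \<open>The first bit splits the cube into two facets, both mapped to boxes by induction. The
  edges matching the facets all point in the same direction, so one box is a translate of the other
  and their union is a box.\<close>

lemma hypercube_image_is_box:
  assumes "inj_on f {xs. length xs = k}"
    and "\<And>xs ys. length xs = k \<Longrightarrow> flip_adj xs ys \<Longrightarrow> grid_adj (f xs) (f ys)"
  shows "\<exists>ds. f ` {xs. length xs = k} = box ds"
  using assms
proof (induction k arbitrary: f)
  case 0
  have "f ` {xs. length xs = 0} = {f []}" by auto
  then show ?case using box_singleton by metis
next
  case (Suc k)
  define X where "X = {xs :: bool list. length xs = k}"
  have X_Suc: "{xs. length xs = Suc k} = (#) e ` X \<union> (#) (\<not> e) ` X" for e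
    by (auto simp: X_def length_Suc_conv image_iff)
  have inj: "f xs = f ys \<longleftrightarrow> xs = ys" if "length xs = Suc k" "length ys = Suc k" for xs ys
    using Suc.prems(1) that by (auto dest: inj_onD)
  have IH: "\<exists>ds. (\<lambda>xs. f (e # xs)) ` X = box ds" for e
    unfolding X_def
  proof (rule Suc.IH)
    show "inj_on (\<lambda>xs. f (e # xs)) {xs. length xs = k}"
      by (rule inj_onI) (simp add: inj)
  qed (simp add: Suc.prems(2))
  have adj: "grid_adj (f (e # xs)) (f ((\<not> e) # xs))" if "length xs = k" for e xs
    using that by (intro Suc.prems(2)) auto
  define xs0 where "xs0 = replicate k False"
  have "grid_adj (f (True # xs0)) (f (False # xs0))"
    using adj[of xs0 True] by (simp add: xs0_def)
  \<comment> \<open>The orientation of the first matching edge is unknown; \<open>e\<close> is the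
    leading bit at its lower end.\<close>
  then obtain j e where je: "raised j (f (e # xs0)) (f ((\<not> e) # xs0))"
    unfolding grid_adj_iff_raised by (metis (full_types))
  \<comment> \<open>Direction \<open>j\<close> spreads from \<open>xs0\<close> over the connected
    facet: neighbouring matching edges are opposite sides of a 4-cycle.\<close>
  have raise: "raised j (f (e # xs)) (f ((\<not> e) # xs))" if "xs \<in> X" for xs
  proof (rule flip_adj_connected[where P = "\<lambda>xs. raised j (f (e # xs)) (f ((\<not> e) # xs))"])
    show "length xs0 = length xs" using that by (simp add: xs0_def X_def)
    show "raised j (f (e # xs0)) (f ((\<not> e) # xs0))" by (rule je)
  next
    fix zs ws assume adj': "flip_adj zs ws" "length zs = length xs0"
      and zs: "raised j (f (e # zs)) (f ((\<not> e) # zs))"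
    have len: "length zs = k" "length ws = k"
      using adj' flip_adj_length by (auto simp: xs0_def)
    \<comment> \<open>The fourth side of the square is traversed backwards, so symmetry is
      required.\<close>
    have "flip_adj ws zs"
      using adj'(1) by (induction zs ws rule: flip_adj.induct) auto
    show "raised j (f (e # ws)) (f ((\<not> e) # ws))"
    proof (rule grid_square_parallel[OF zs])
      show "grid_adj (f (e # zs)) (f (e # ws))"
        using adj'(1) len by (intro Suc.prems(2)) auto
      show "grid_adj (f (e # ws)) (f ((\<not> e) # ws))"
        using adj len by blast
      show "grid_adj (f ((\<not> e) # ws)) (f ((\<not> e) # zs))"
        using \<open>flip_adj ws zs\<close> len by (intro Suc.prems(2)) auto
    qed (use len in \<open>auto simp: inj\<close>)
  qed
  obtain ds where ds: "(\<lambda>xs. f (e # xs)) ` X = box ds" using IH by blast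
  have "\<exists>es. (\<lambda>xs. f (e # xs)) ` X \<union> (\<lambda>xs. f ((\<not> e) # xs)) ` X = box es"
    using ds raise
  proof (rule union_raised_box)
    show "(\<lambda>xs. f (e # xs)) ` X \<inter> (\<lambda>xs. f ((\<not> e) # xs)) ` X = {}"
      by (auto simp: inj X_def)
  qed
  then show ?case
    unfolding X_Suc[of e] image_Un image_image .
qed

section \<open>Every box is a hypercube: one bit is spent on each edge cell\<close>

fun cube_embed :: "(nat \<times> bool) list \<Rightarrow> bool list \<Rightarrow> nat list" where
  "cube_embed [] bs = []"
| "cube_embed ((c, e) # ds) bs =
    (if e then (if hd bs then Suc c else c) # cube_embed ds (tl bs) else c # cube_embed ds bs)"

lemma embed_inject:
  "length xs = dims ds \<Longrightarrow> length ys = dims ds \<Longrightarrow> cube_embed ds xs = cube_embed ds ys \<longleftrightarrow> xs = ys"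
proof (induction ds xs arbitrary: ys rule: cube_embed.induct)
  case (2 c e ds bs)
  then show ?case by (cases bs; cases ys) (auto split: if_splits)
qed simp

text \<open>A vertex cell contributes equal letters; an edge cell contributes letters that are equal
  or consecutive according to whether the bits agree.\<close>

lemma grid_adj_embed:
  "length xs = dims ds \<Longrightarrow> length ys = dims ds \<Longrightarrow>
    grid_adj (cube_embed ds xs) (cube_embed ds ys) \<longleftrightarrow> flip_adj xs ys"
proof (induction ds xs arbitrary: ys rule: cube_embed.induct)
  case (2 c e ds bs)
  then show ?case
    by (cases bs; cases ys) (auto simp: embed_inject split: if_splits)
qed simp

lemma embed_image: "cube_embed ds ` {bs. length bs = dims ds} = box ds"
proof (induction ds)
  case (Cons d ds)
  obtain c e where d: "d = (c, e)" by (cases d)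
  have Suc: "{bs :: bool list. length bs = Suc k} = (\<lambda>(x, xs). x # xs) ` (UNIV \<times> {bs. length bs = k})" for k
    by (auto simp: length_Suc_conv image_iff)
  show ?case
  proof (cases e)
    case True
    have "cube_embed (d # ds) ` {bs. length bs = dims (d # ds)} =
        (\<lambda>(x, xs). x # xs) ` (cell d \<times> cube_embed ds ` {bs. length bs = dims ds})"
      using True by (force simp: d Suc image_iff)
    then show ?thesis by (simp add: Cons.IH box_Cons)
  next
    case False
    then have "cube_embed (d # ds) ` {bs. length bs = dims (d # ds)} =
        (\<lambda>(x, xs). x # xs) ` (cell d \<times> cube_embed ds ` {bs. length bs = dims ds})"
      by (force simp: d image_iff)
    then show ?thesis by (simp add: Cons.IH box_Cons)
  qed
qed simp

lemma inj_on_embed: "inj_on (cube_embed ds) {bs. length bs = dims ds}"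
  by (rule inj_onI) (simp add: embed_inject)

lemma hypercube_in_grid_iff:
  "(\<exists>f. inj_on f (pverts (hypercube k)) \<and> f ` pverts (hypercube k) = V \<and>
      map_prod f f ` parcs (hypercube k) = {(x, y). grid_adj x y} \<inter> V \<times> V) \<longleftrightarrow>
    (\<exists>ds. V = box ds \<and> dims ds = k)" (is "?L \<longleftrightarrow> ?R")
proof
  assume ?L
  then obtain f where f: "inj_on f {xs. length xs = k}" "f ` {xs. length xs = k} = V"
    "map_prod f f ` {(xs, ys). length xs = k \<and> length ys = k \<and> flip_adj xs ys} =
      {(x, y). grid_adj x y} \<inter> V \<times> V"
    unfolding hypercube_simps by blast
  have "grid_adj (f xs) (f ys)" if "length xs = k" "flip_adj xs ys" for xs ys
  proof -
    have "(f xs, f ys) \<in> map_prod f f ` {(xs, ys). length xs = k \<and> length ys = k \<and> flip_adj xs ys}"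
      using that flip_adj_length[OF that(2)] by (intro image_eqI[of _ _ "(xs, ys)"]) auto
    then show ?thesis unfolding f(3) by simp
  qed
  then obtain ds where ds: "V = box ds"
    using hypercube_image_is_box[OF f(1)] f(2) by auto
  \<comment> \<open>The box found so far has some dimension; comparing cardinalities shows that it
    is \<open>k\<close>.\<close>
  have card_cube: "card {xs :: bool list. length xs = m} = 2 ^ m" for m
    using card_lists_length_eq[of "UNIV :: bool set" m] by simp
  have "card V = 2 ^ k"
    using card_image[OF f(1)] by (simp add: f(2) card_cube)
  moreover have "card V = 2 ^ dims ds"
    using card_image[OF inj_on_embed[of ds]] by (simp add: embed_image ds card_cube)
  ultimately show ?R using ds by auto
next
  assume ?R
  then obtain ds where ds: "V = box ds" "dims ds = k" by blast
  define Q where "Q = {xs :: bool list. length xs = k}"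
  have V: "V = cube_embed ds ` Q" unfolding ds(1) Q_def ds(2)[symmetric] embed_image ..
  have "map_prod (cube_embed ds) (cube_embed ds) ` (Q \<times> Q \<inter> {(xs, ys). flip_adj xs ys}) =
      {(x, y). grid_adj x y} \<inter> V \<times> V"
    unfolding V using grid_adj_embed[of _ ds] ds(2) by (auto simp: Q_def image_iff)
  moreover have "parcs (hypercube k) = Q \<times> Q \<inter> {(xs, ys). flip_adj xs ys}"
    by (auto simp: hypercube_simps Q_def)
  ultimately show ?L
    using inj_on_embed[of ds] V by (intro exI[of _ "cube_embed ds"]) (simp add: hypercube_simps Q_def ds(2))
qed

section \<open>Counting boxes of Horadam strings\<close>

text \<open>
  \<open>admissible a b z xs\<close>: the string \<open>xs\<close> may be appended to a Horadam string; the flag \<open>z\<close> says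
  whether that string ends in \<open>0\<close>.
\<close>

fun admissible :: "nat \<Rightarrow> nat \<Rightarrow> bool \<Rightarrow> nat list \<Rightarrow> bool" where
  "admissible a b z [] = True"
| "admissible a b z (x # xs) = (x < a + b \<and> (a \<le> x \<longrightarrow> z) \<and> admissible a b (x = 0) xs)"

text \<open>The upper letter \<open>c + of_bool e\<close> of a cell is the binding one. The flag
  passed on holds only for the vertex cell 0, as any other cell contains a nonzero letter.\<close>

fun admissible_box :: "nat \<Rightarrow> nat \<Rightarrow> bool \<Rightarrow> (nat \<times> bool) list \<Rightarrow> bool" where
  "admissible_box a b z [] = True"
| "admissible_box a b z ((c, e) # ds) =
    (c + of_bool e < a + b \<and> (a \<le> c + of_bool e \<longrightarrow> z) \<and> admissible_box a b (c = 0 \<and> \<not> e) ds)"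

lemma admissible_iff_nth:
  "admissible a b z xs \<longleftrightarrow> set xs \<subseteq> {0..<a + b} \<and>
    (\<forall>i<length xs. a \<le> xs ! i \<longrightarrow> (if i = 0 then z else xs ! (i - 1) = 0))"
proof (induction xs arbitrary: z)
  case (Cons x xs)
  have "(\<forall>i<length (x # xs). a \<le> (x # xs) ! i \<longrightarrow> (if i = 0 then z else (x # xs) ! (i - 1) = 0)) \<longleftrightarrow>
      (a \<le> x \<longrightarrow> z) \<and> (\<forall>i<length xs. a \<le> xs ! i \<longrightarrow> (if i = 0 then x = 0 else xs ! (i - 1) = 0))"
    unfolding length_Cons All_less_Suc2 by (simp add: nth_Cons')
  then show ?case
    using Cons.IH by auto
qed simp

lemma horadam_strings_eq: "horadam_strings a b n = {xs. length xs = n \<and> admissible a b False xs}"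
proof -
  have "(if i = 0 then False else P) \<longleftrightarrow> 0 < i \<and> P" for i :: nat and P
    by simp
  then show ?thesis
    unfolding horadam_strings_def admissible_iff_nth by auto
qed

lemma admissible_mono: "admissible a b False xs \<Longrightarrow> admissible a b z xs"
  by (cases xs) auto

text \<open>The rest of a box must be admissible after every letter of the first cell. By
  \<open>admissible_mono\<close> the flag \<open>False\<close> is the strictest, and it occurs
  unless the cell is constantly 0.\<close>

lemma box_subset_admissible_iff:
  "box ds \<subseteq> {xs. admissible a b z xs} \<longleftrightarrow> admissible_box a b z ds"
proof (induction ds arbitrary: z)
  case (Cons d ds)
  obtain c e where d: "d = (c, e)" by (cases d)
  \<comment> \<open>Without a tail in \<open>box ds\<close> the conditions on the first letter would
    hold vacuously.\<close>
  have ne: "box ds \<noteq> {}" using corner_in_box by blast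
  have "box (d # ds) \<subseteq> {xs. admissible a b z xs} \<longleftrightarrow>
      (\<forall>x\<in>cell d. x < a + b \<and> (a \<le> x \<longrightarrow> z) \<and> (\<forall>xs\<in>box ds. admissible a b (x = 0) xs))"
    using ne by (auto simp: box_Cons)
  also have "\<dots> \<longleftrightarrow> c + of_bool e < a + b \<and> (a \<le> c + of_bool e \<longrightarrow> z) \<and>
      (\<forall>xs\<in>box ds. admissible a b (c = 0 \<and> \<not> e) xs)"
    using admissible_mono by (cases e) (auto simp: d)
  also have "(\<forall>xs\<in>box ds. admissible a b (c = 0 \<and> \<not> e) xs) \<longleftrightarrow> admissible_box a b (c = 0 \<and> \<not> e) ds"
    unfolding Cons.IH[symmetric] by blast
  finally show ?case by (simp add: d)
qed simp

definition admissible_boxes :: "nat \<Rightarrow> nat \<Rightarrow> bool \<Rightarrow> nat \<Rightarrow> nat \<Rightarrow> (nat \<times> bool) list set" where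
  "admissible_boxes a b z n k = {ds. length ds = n \<and> dims ds = k \<and> admissible_box a b z ds}"

lemma pair_wf_digraph_horadam_cube: "pair_wf_digraph (horadam_cube a b n)"
  by unfold_locales (auto simp: horadam_cube_simps)

text \<open>On Horadam strings the arcs are those of the grid, so the induced copies of the
  hypercube are the boxes contained in \<open>horadam_strings a b n\<close>, one for each descriptor
  list.\<close>

lemma cube_coeff_horadam_cube:
  "cube_coeff k (horadam_cube a b n) = card (admissible_boxes a b False n k)"
proof -
  have arcs: "parcs (horadam_cube a b n) \<inter> V \<times> V = {(x, y). grid_adj x y} \<inter> V \<times> V"
    if "V \<subseteq> horadam_strings a b n" for V
    using that by (auto simp: horadam_cube_simps)
  have len: "box ds \<subseteq> {xs. length xs = n} \<longleftrightarrow> length ds = n" for ds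
  proof
    assume "box ds \<subseteq> {xs. length xs = n}"
    then have "map fst ds \<in> {xs. length xs = n}" using corner_in_box by blast
    then show "length ds = n" by simp
  qed (auto simp: in_box_iff_nth)
  have "box ds \<subseteq> horadam_strings a b n \<longleftrightarrow> length ds = n \<and> admissible_box a b False ds" for ds
    unfolding box_subset_admissible_iff[symmetric] len[symmetric] horadam_strings_eq by blast
  then have "{V. V \<subseteq> horadam_strings a b n \<and> (\<exists>ds. V = box ds \<and> dims ds = k)} =
      box ` admissible_boxes a b False n k"
    unfolding admissible_boxes_def by blast
  moreover have "cube_coeff k (horadam_cube a b n) =
      card {V. V \<subseteq> horadam_strings a b n \<and> (\<exists>ds. V = box ds \<and> dims ds = k)}"
    unfolding cube_coeff_eq_card_vertex_sets[OF pair_wf_digraph_horadam_cube]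
      hypercube_in_grid_iff[symmetric] horadam_cube_simps(1)
    by (intro arg_cong[of _ _ card] Collect_cong conj_cong refl) (simp add: arcs)
  ultimately show ?thesis
    by (simp add: card_image inj_on_def box_inject)
qed

lemma admissible_boxes_0: "admissible_boxes a b z 0 k = (if k = 0 then {[]} else {})"
  by (auto simp: admissible_boxes_def)

lemma finite_admissible_boxes: "finite (admissible_boxes a b z n k)"
proof (rule finite_subset)
  show "admissible_boxes a b z n k \<subseteq> {ds. set ds \<subseteq> {..<a + b} \<times> UNIV \<and> length ds = n}"
  proof -
    have "set ds \<subseteq> {..<a + b} \<times> UNIV" if "admissible_box a b z ds" for z ds
      using that by (induction a b z ds rule: admissible_box.induct) auto
    then show ?thesis by (auto simp: admissible_boxes_def)
  qed
qed (simp add: finite_lists_length_eq)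

section \<open>Recursions from splitting off the first cell\<close>

definition cons_cells :: "nat set \<Rightarrow> bool \<Rightarrow> (nat \<times> bool) list set \<Rightarrow> (nat \<times> bool) list set" where
  "cons_cells C e D = (\<lambda>(c, ds). (c, e) # ds) ` (C \<times> D)"

lemma card_cons_cells: "card (cons_cells C e D) = card C * card D"
  unfolding cons_cells_def by (subst card_image) (auto simp: inj_on_def card_cartesian_product)

lemma finite_cons_cells: "finite C \<Longrightarrow> finite D \<Longrightarrow> finite (cons_cells C e D)"
  by (simp add: cons_cells_def)

lemma Cons_in_cons_cells:
  "d # ds \<in> cons_cells C e D \<longleftrightarrow> fst d \<in> C \<and> snd d = e \<and> ds \<in> D"
  by (cases d) (auto simp: cons_cells_def)

lemma Nil_notin_cons_cells: "[] \<notin> cons_cells C e D"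
  by (auto simp: cons_cells_def)

lemma cons_cells_disjoint:
  "e \<noteq> e' \<or> C \<inter> C' = {} \<Longrightarrow> cons_cells C e D \<inter> cons_cells C' e' D' = {}"
  by (auto simp: cons_cells_def)

text \<open>The guard \<open>of_bool e \<le> k\<close> rules out an edge cell for
  \<open>k = 0\<close>, where truncated subtraction would give 0 again.\<close>

lemma Cons_in_admissible_boxes_Suc:
  "(c, e) # ds \<in> admissible_boxes a b z (Suc n) k \<longleftrightarrow>
    c + of_bool e < a + b \<and> (a \<le> c + of_bool e \<longrightarrow> z) \<and> of_bool e \<le> k \<and>
    ds \<in> admissible_boxes a b (c = 0 \<and> \<not> e) n (k - of_bool e)"
  by (auto simp: admissible_boxes_def)

abbreviation (input) num_boxes :: "nat \<Rightarrow> nat \<Rightarrow> bool \<Rightarrow> nat \<Rightarrow> nat \<Rightarrow> nat" where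
  "num_boxes a b z n k \<equiv> card (admissible_boxes a b z n k)"

text \<open>The first cell is the vertex 0, one of the \<open>a - 1\<close> nonzero vertices below
  \<open>a\<close>, or one of the \<open>a - 1\<close> edges among the letters below
  \<open>a\<close>. Only the first choice passes on the flag \<open>True\<close>.\<close>

lemma num_boxes_False_Suc:
  assumes "a \<ge> 1"
  shows "num_boxes a b False (Suc n) k = num_boxes a b True n k +
    (a - 1) * num_boxes a b False n k +
    (a - 1) * (if k = 0 then 0 else num_boxes a b False n (k - 1))"
proof -
  define A where "A = cons_cells {0} False (admissible_boxes a b True n k)"
  define B where "B = cons_cells {1..<a} False (admissible_boxes a b False n k)"
  define C where "C = cons_cells {..<a - 1} True
    (if k = 0 then {} else admissible_boxes a b False n (k - 1))"
  have "ds \<in> admissible_boxes a b False (Suc n) k \<longleftrightarrow> ds \<in> A \<union> B \<union> C" for ds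
  proof (cases ds)
    case Nil
    then show ?thesis
      by (simp add: A_def B_def C_def Nil_notin_cons_cells admissible_boxes_def)
  next
    case (Cons d es)
    obtain c e where d: "d = (c, e)" by (cases d)
    show ?thesis
      unfolding Cons d Cons_in_admissible_boxes_Suc A_def B_def C_def Un_iff Cons_in_cons_cells
      using assms by (cases e; cases "c = 0") auto
  qed
  then have "admissible_boxes a b False (Suc n) k = A \<union> B \<union> C" by blast
  moreover have "A \<inter> B = {}" "(A \<union> B) \<inter> C = {}"
    unfolding A_def B_def C_def Int_Un_distrib2 by (simp_all add: cons_cells_disjoint)
  moreover have "finite A" "finite B" "finite C"
    by (simp_all add: A_def B_def C_def finite_cons_cells finite_admissible_boxes)
  ultimately show ?thesis
    by (simp add: card_Un_disjoint) (simp add: A_def B_def C_def card_cons_cells)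
qed

text \<open>After a 0 the cells reaching \<open>a\<close> or beyond are allowed too:
  \<open>b\<close> vertices and \<open>b\<close> edges. None of them is constantly 0, so all pass on
  \<open>False\<close>.\<close>

lemma num_boxes_True_Suc:
  assumes "a \<ge> 1"
  shows "num_boxes a b True (Suc n) k = num_boxes a b False (Suc n) k +
    b * num_boxes a b False n k + b * (if k = 0 then 0 else num_boxes a b False n (k - 1))"
proof -
  define A where "A = admissible_boxes a b False (Suc n) k"
  define B where "B = cons_cells {a..<a + b} False (admissible_boxes a b False n k)"
  \<comment> \<open>Cells are indexed by their lower end, so the range starts with the edge from
    \<open>a - 1\<close> to \<open>a\<close>.\<close>
  define C where "C = cons_cells {a - 1..<a + b - 1} True
    (if k = 0 then {} else admissible_boxes a b False n (k - 1))"
  have mem: "(c, e) # ds \<in> A \<longleftrightarrow> c + of_bool e < a \<and> of_bool e \<le> k \<and>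
      ds \<in> admissible_boxes a b (c = 0 \<and> \<not> e) n (k - of_bool e)" for c e ds
    unfolding A_def Cons_in_admissible_boxes_Suc by auto
  have "ds \<in> admissible_boxes a b True (Suc n) k \<longleftrightarrow> ds \<in> A \<union> B \<union> C" for ds
  proof (cases ds)
    case Nil
    then show ?thesis
      by (simp add: A_def B_def C_def Nil_notin_cons_cells admissible_boxes_def)
  next
    case (Cons d es)
    obtain c e where d: "d = (c, e)" by (cases d)
    show ?thesis
      unfolding Cons d Cons_in_admissible_boxes_Suc mem B_def C_def Un_iff Cons_in_cons_cells
      using assms by (cases e; cases "c = 0") auto
  qed
  then have "admissible_boxes a b True (Suc n) k = A \<union> B \<union> C" by blast
  moreover have "A \<inter> B = {}" "A \<inter> C = {}"
    using mem by (auto simp: B_def C_def cons_cells_def)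
  moreover have "B \<inter> C = {}"
    unfolding B_def C_def by (simp add: cons_cells_disjoint)
  moreover have "finite A" "finite B" "finite C"
    by (simp_all add: A_def B_def C_def finite_cons_cells finite_admissible_boxes)
  ultimately show ?thesis
    using assms
    by (simp add: card_Un_disjoint Int_Un_distrib2) (simp add: A_def B_def C_def card_cons_cells)
qed

lemma num_boxes_Suc_Suc:
  assumes "a \<ge> 1"
  shows "num_boxes a b False (Suc (Suc n)) k =
    a * num_boxes a b False (Suc n) k + b * num_boxes a b False n k +
    (a - 1) * (if k = 0 then 0 else num_boxes a b False (Suc n) (k - 1)) +
    b * (if k = 0 then 0 else num_boxes a b False n (k - 1))"
proof -
  \<comment> \<open>The coefficient \<open>a\<close> arises as \<open>1 + (a - 1)\<close>: one share
    from the \<open>True\<close> count, the rest from the nonzero vertices.\<close>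
  have "a * m = m + (a - 1) * m" for m
    using assms by (cases a) auto
  then show ?thesis
    unfolding num_boxes_False_Suc[OF assms, of b "Suc n"] num_boxes_True_Suc[OF assms, of b n k]
    by simp
qed

lemma num_boxes_dim_0: "num_boxes a b False n 0 = horadam_number a b n"
proof -
  have flat: "admissible_box a b z (map (\<lambda>c. (c, False)) xs) \<longleftrightarrow> admissible a b z xs" for z xs
    by (induction xs arbitrary: z) auto
  have dims_0: "dims ds = 0 \<longleftrightarrow> ds = map (\<lambda>c. (c, False)) (map fst ds)" for ds
    by (induction ds) (auto simp: prod_eq_iff)
  have "admissible_boxes a b False n 0 = map (\<lambda>c. (c, False)) ` horadam_strings a b n"
  proof (intro equalityI subsetI)
    fix ds assume ds: "ds \<in> admissible_boxes a b False n 0"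
    then have eq: "ds = map (\<lambda>c. (c, False)) (map fst ds)"
      unfolding admissible_boxes_def dims_0 by blast
    moreover have "map fst ds \<in> horadam_strings a b n"
      using ds flat[of False "map fst ds"] unfolding eq[symmetric]
      by (simp add: admissible_boxes_def horadam_strings_eq)
    ultimately show "ds \<in> map (\<lambda>c. (c, False)) ` horadam_strings a b n" by (rule image_eqI)
  qed (auto simp: admissible_boxes_def horadam_strings_eq flat)
  moreover have "inj (map (\<lambda>c :: nat. (c, False)))"
    by (simp add: inj_on_def)
  ultimately show ?thesis
    by (simp add: horadam_number_def card_image inj_on_subset[OF _ subset_UNIV])
qed

section \<open>The generating function\<close>

unbundle fps_syntax

text \<open>The coefficients will themselves be series in \<open>y\<close>, hence not a field.
  Constant term 1 together with \<open>inverse 1 = 1\<close> makes \<open>inverse g\<close> a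
  genuine inverse.\<close>

lemma fps_one_divide_unique:
  fixes f g :: "'a :: {comm_ring_1, inverse} fps"
  assumes "f * g = 1" and "g $ 0 = 1" and "inverse (1 :: 'a) = 1"
  shows "f = 1 / g"
proof -
  have "subdegree g = 0" "g \<noteq> 0"
    using assms(2) by auto
  then have "1 / g = inverse g"
    by (simp add: fps_divide_unit')
  moreover have "g * inverse g = 1"
    using assms by (simp add: fps_inverse_def fps_right_inverse)
  ultimately show ?thesis
    using assms(1) by (metis mult.assoc mult.commute mult_1)
qed

text \<open>The denominator is grouped by powers of the outer variable: \<open>P\<close> and
  \<open>Q\<close> are the series in \<open>y\<close> multiplying \<open>x\<close> and
  \<open>x ^ 2\<close>. Comparing coefficients gives the recurrence.\<close>

lemma horadam_gf_mult:
  fixes a b :: nat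
  assumes "a \<ge> 1"
  defines "P \<equiv> of_nat a + (of_nat a - 1) * fps_X :: rat fps"
    and "Q \<equiv> of_nat b + of_nat b * fps_X :: rat fps"
  shows "horadam_gf a b * (1 - fps_const P * fps_X - fps_const Q * fps_X ^ 2) = 1"
proof (rule fps_ext)
  fix n
  define A where "A = horadam_gf a b"
  define F where "F n k = num_boxes a b False n k" for n k
  have A: "A $ n $ k = of_nat (F n k)" for n k
    by (simp add: A_def F_def horadam_gf_def cube_coeff_horadam_cube)
  have mult_P: "(P * f) $ k = of_nat a * f $ k + of_nat (a - 1) * (if k = 0 then 0 else f $ (k - 1))"
    for f k
  proof -
    \<comment> \<open>The ring subtraction agrees with the truncated one because
      \<open>a \<ge> 1\<close>.\<close>
    have "of_nat a - 1 = (of_nat (a - 1) :: rat fps)"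
      using assms(1) by (simp add: of_nat_diff)
    then have "P = fps_const (of_nat a) + fps_const (of_nat (a - 1)) * fps_X"
      by (simp only: P_def fps_of_nat)
    then have "P * f = fps_const (of_nat a) * f + fps_const (of_nat (a - 1)) * (fps_X * f)"
      by (simp only: distrib_right mult.assoc)
    then show ?thesis by simp
  qed
  have mult_Q: "(Q * f) $ k = of_nat b * f $ k + of_nat b * (if k = 0 then 0 else f $ (k - 1))"
    for f k
  proof -
    have "Q * f = fps_const (of_nat b) * f + fps_const (of_nat b) * (fps_X * f)"
      by (simp only: Q_def fps_of_nat distrib_right mult.assoc)
    then show ?thesis by simp
  qed
  have "A * (1 - fps_const P * fps_X - fps_const Q * fps_X ^ 2) =
      A - fps_const P * (A * fps_X) - fps_const Q * (A * fps_X ^ 2)"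
    by (simp add: algebra_simps)
  then have coeff: "(A * (1 - fps_const P * fps_X - fps_const Q * fps_X ^ 2)) $ n =
      A $ n - P * (if n = 0 then 0 else A $ (n - 1)) - Q * (if n < 2 then 0 else A $ (n - 2))"
    by (simp add: fps_X_power_mult_right_nth)
  have F0: "F 0 k = (if k = 0 then 1 else 0)" "num_boxes a b True 0 k = (if k = 0 then 1 else 0)" for k
    by (simp_all add: F_def admissible_boxes_0)
  consider "n = 0" | "n = 1" | m where "n = Suc (Suc m)"
    by (metis One_nat_def not0_implies_Suc)
  then show "(horadam_gf a b * (1 - fps_const P * fps_X - fps_const Q * fps_X ^ 2)) $ n = 1 $ n"
  proof cases
    case 1
    then show ?thesis
      unfolding A_def[symmetric] coeff by (intro fps_ext) (simp add: A F0)
  next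
    case 2
    \<comment> \<open>The two-step recurrence starts only at length 2. Here the first-cell recursion
      is used, and at length 0 both flags give the same count.\<close>
    have "F 1 k = a * F 0 k + (a - 1) * (if k = 0 then 0 else F 0 (k - 1))" for k
      using num_boxes_False_Suc[OF assms(1), of b 0 k] assms(1) F0 by (simp add: F_def)
    then show ?thesis
      using 2 unfolding A_def[symmetric] coeff by (intro fps_ext) (simp add: A mult_P)
  next
    case 3
    have "F n k = a * F (Suc m) k + b * F m k + (a - 1) * (if k = 0 then 0 else F (Suc m) (k - 1)) +
        b * (if k = 0 then 0 else F m (k - 1))" for k
      unfolding F_def 3 by (rule num_boxes_Suc_Suc[OF assms(1)])
    then show ?thesis
      using 3 unfolding A_def[symmetric] coeff by (intro fps_ext) (simp add: A mult_P mult_Q)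
  qed
qed

theorem theorem13:
  fixes a b :: nat
  assumes "a \<ge> 1" and "b \<ge> 1"
  shows
    "(\<forall>n\<ge>2. \<forall>k.
        cube_coeff k (horadam_cube a b n) =
          a * cube_coeff k (horadam_cube a b (n - 1))
        + b * cube_coeff k (horadam_cube a b (n - 2))
        + (a - 1) * (if k = 0 then 0 else cube_coeff (k - 1) (horadam_cube a b (n - 1)))
        + b * (if k = 0 then 0 else cube_coeff (k - 1) (horadam_cube a b (n - 2))))
   \<and> (\<forall>n. cube_coeff 0 (horadam_cube a b n) = horadam_number a b n)
   \<and> cube_coeff 1 (horadam_cube a b 1) = a - 1
   \<and> (let x = fps_X; y = fps_const fps_X in
        horadam_gf a b =
          1 / (1 - of_nat a * x - of_nat b * x ^ 2 - (of_nat a - 1) * x * y - of_nat b * x ^ 2 * y))"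
proof (intro conjI)
  show "\<forall>n\<ge>2. \<forall>k.
        cube_coeff k (horadam_cube a b n) =
          a * cube_coeff k (horadam_cube a b (n - 1))
        + b * cube_coeff k (horadam_cube a b (n - 2))
        + (a - 1) * (if k = 0 then 0 else cube_coeff (k - 1) (horadam_cube a b (n - 1)))
        + b * (if k = 0 then 0 else cube_coeff (k - 1) (horadam_cube a b (n - 2)))"
  proof (intro allI impI)
    fix n k :: nat assume "2 \<le> n"
    then obtain m where "n = Suc (Suc m)" by (metis Suc_le_D numeral_2_eq_2 Suc_le_mono)
    then show "cube_coeff k (horadam_cube a b n) =
          a * cube_coeff k (horadam_cube a b (n - 1))
        + b * cube_coeff k (horadam_cube a b (n - 2))
        + (a - 1) * (if k = 0 then 0 else cube_coeff (k - 1) (horadam_cube a b (n - 1)))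
        + b * (if k = 0 then 0 else cube_coeff (k - 1) (horadam_cube a b (n - 2)))"
      unfolding cube_coeff_horadam_cube using num_boxes_Suc_Suc[OF assms(1), of b m k] by simp
  qed
  show "\<forall>n. cube_coeff 0 (horadam_cube a b n) = horadam_number a b n"
    by (simp add: cube_coeff_horadam_cube num_boxes_dim_0)
  show "cube_coeff 1 (horadam_cube a b 1) = a - 1"
    using num_boxes_False_Suc[OF assms(1), of b 0 1]
    by (simp add: cube_coeff_horadam_cube admissible_boxes_0)
  define P where "P = (of_nat a + (of_nat a - 1) * fps_X :: rat fps)"
  define Q where "Q = (of_nat b + of_nat b * fps_X :: rat fps)"
  \<comment> \<open>\<open>fps_const\<close> is a ring homomorphism, so it turns \<open>P\<close>
    into the polynomial in \<open>y = fps_const fps_X\<close> of the closed form.\<close>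
  have P: "fps_const P = of_nat a + (of_nat a - 1) * fps_const fps_X"
    by (simp add: P_def fps_of_nat flip: fps_const_add fps_const_sub fps_const_mult)
  have Q: "fps_const Q = of_nat b + of_nat b * fps_const fps_X"
    by (simp add: Q_def fps_of_nat flip: fps_const_add fps_const_mult)
  have "horadam_gf a b = 1 / (1 - fps_const P * fps_X - fps_const Q * fps_X ^ 2)"
  proof (rule fps_one_divide_unique)
    show "horadam_gf a b * (1 - fps_const P * fps_X - fps_const Q * fps_X ^ 2) = 1"
      unfolding P_def Q_def by (rule horadam_gf_mult[OF assms(1)])
  qed (simp_all add: fps_X_power_mult_right_nth)
  also have "1 - fps_const P * fps_X - fps_const Q * fps_X ^ 2 =
      1 - of_nat a * fps_X - of_nat b * fps_X ^ 2 - (of_nat a - 1) * fps_X * fps_const fps_X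
        - of_nat b * fps_X ^ 2 * fps_const fps_X"
    unfolding P Q by (simp add: algebra_simps)
  finally show "let x = fps_X; y = fps_const fps_X in
        horadam_gf a b =
          1 / (1 - of_nat a * x - of_nat b * x ^ 2 - (of_nat a - 1) * x * y - of_nat b * x ^ 2 * y)"
    by (simp add: Let_def)
qed

end
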